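(* Let $M,N\ge2$ be integers and $0<p_0<1$ with $L_{p_0}>0$, and assume $N=\kappa^k$, $M=\kappa^\ell$ with $\kappa>1$ an integer and $k,\ell\ge1$ relatively prime integers. Then the iterated function system generated by the two-point maps $f^{(2)}_i$, $0\le i\le M$, with probabilities $p_i$, admits an absolutely continuous stationary measure $m^{(2)}$ of the form $$m^{(2)}=\sum_{h=0}^\infty b_h\sum_{j=0}^{\kappa^h-1}\kappa^h\,\lambda|_{[j/\kappa^h,(j+1)/\kappa^h)^2},$$ where $(b_h)_{h\ge0}$ is a sequence of nonnegative real numbers satisfying the recurrence $$b_{j+k+\ell}=\frac1{p_0}b_{j+\ell}-\frac{1-p_0}{p_0}b_j,\qquad j\ge0,$$ for a suitable initial condition on $b_0,\dots,b_{\ell-1}$. Moreover, with $\nu_1$ the unique real solution in $(0,1)$ of $p_0\zeta^{k+\ell}-\zeta^\ell+1-p_0=0$, the limit $\lim_{h\to\infty}b_h/\nu_1^h$ exists and is a positive number.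
   Context: The maps $f_i:[0,1)\to[0,1)$ are $f_0(x)=Nx\pmod 1$ and $f_i(x)=(x+i-1)/M$ for $1\le i\le M$. The two-point maps are $f^{(2)}_i(x,y)=(f_i(x),f_i(y))$ on $[0,1)^2$. The probabilities are $p_0$ and $p_i=(1-p_0)/M$ for $1\le i\le M$. A measure $m$ on $[0,1)^2$ is stationary if $m=\sum_{i=0}^Mp_i\,(f^{(2)}_i)_*m$, where $(g)_*m(A)=m(g^{-1}(A))$. The Lyapunov exponent is $L_{p_0}=p_0\ln N-(1-p_0)\ln M$. $\lambda|_A$ is two-dimensional Lebesgue measure restricted to $A$, and absolute continuity is with respect to two-dimensional Lebesgue measure. *)

theory Defs
  imports "HOL-Analysis.Analysis"
begin

definition unit_square :: "(real \<times> real) set" where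
  "unit_square = {0..<1} \<times> {0..<1}"

text \<open>The maps are only meant on \<open>[0,1)\<close>, which each of them maps into itself.\<close>

definition ifs_map :: "nat \<Rightarrow> nat \<Rightarrow> nat \<Rightarrow> real \<Rightarrow> real" where
  "ifs_map N M i x = (if i = 0 then frac (real N * x) else (x + real i - 1) / real M)"

definition two_point_map :: "nat \<Rightarrow> nat \<Rightarrow> nat \<Rightarrow> real \<times> real \<Rightarrow> real \<times> real" where
  "two_point_map N M i = map_prod (ifs_map N M i) (ifs_map N M i)"

definition ifs_prob :: "nat \<Rightarrow> real \<Rightarrow> nat \<Rightarrow> real" where
  "ifs_prob M p0 i = (if i = 0 then p0 else (1 - p0) / real M)"

definition lyapunov_exponent :: "nat \<Rightarrow> nat \<Rightarrow> real \<Rightarrow> real" where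
  "lyapunov_exponent N M p0 = p0 * ln (real N) - (1 - p0) * ln (real M)"

text \<open>Measures on \<open>[0,1)\<^sup>2\<close> are Borel measures whose underlying space is the unit square. No
  normalisation or finiteness is part of the definition.\<close>

definition stationary_measure :: "nat \<Rightarrow> nat \<Rightarrow> real \<Rightarrow> (real \<times> real) measure \<Rightarrow> bool" where
  "stationary_measure N M p0 m \<longleftrightarrow>
     sets m = sets (restrict_space borel unit_square) \<and>
     (\<forall>A\<in>sets m. emeasure m A =
        (\<Sum>i\<le>M. ennreal (ifs_prob M p0 i) * emeasure (distr m m (two_point_map N M i)) A))"

definition diag_square :: "nat \<Rightarrow> nat \<Rightarrow> nat \<Rightarrow> (real \<times> real) set" where
  "diag_square \<kappa> h j =
     {real j / real \<kappa> ^ h ..< (real j + 1) / real \<kappa> ^ h} \<times>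
     {real j / real \<kappa> ^ h ..< (real j + 1) / real \<kappa> ^ h}"

text \<open>\<open>\<lambda>|\<^sub>A\<close>, as a measure on the whole plane: it sends \<open>B\<close> to \<open>\<lambda>(A \<inter> B)\<close>.\<close>

definition lebesgue_restricted :: "(real \<times> real) set \<Rightarrow> (real \<times> real) measure" where
  "lebesgue_restricted A = density lborel (indicator A)"

definition diag_root :: "real \<Rightarrow> nat \<Rightarrow> nat \<Rightarrow> real \<Rightarrow> bool" where
  "diag_root p0 k l \<zeta> \<longleftrightarrow> 0 < \<zeta> \<and> \<zeta> < 1 \<and> p0 * \<zeta> ^ (k + l) - \<zeta> ^ l + 1 - p0 = 0"

end

theory Submission imports Defs begin

text \<open>
  Write \<open>\<mu>\<^sub>h\<close> for the uniform probability on the \<open>\<kappa>\<^sup>h\<close> diagonal squares of side \<open>\<kappa>\<^sup>-\<^sup>h\<close>. The maps of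
  the system carry these measures to one another: the expansion \<open>f\<^sub>0\<close> pushes \<open>\<mu>\<^sub>h\<close> to \<open>\<mu>\<^sub>h\<^sub>-\<^sub>k\<close>, or to \<open>\<mu>\<^sub>0\<close> if \<open>h < k\<close>
  (\<open>diag_avg_expansion\<close>), and the average over the \<open>M\<close> contractions pushes \<open>\<mu>\<^sub>h\<close> to \<open>\<mu>\<^sub>h\<^sub>+\<^sub>l\<close>
  (\<open>diag_avg_contractions\<close>). Hence \<open>\<Sum>\<^sub>h b\<^sub>h \<mu>\<^sub>h\<close> is stationary as soon as \<open>b\<close> is a stationary measure of
  the random walk on the scales \<open>h \<in> \<nat>\<close> that jumps to \<open>h + l\<close> with probability \<open>1 - p\<close> and to
  \<open>max (h - k) 0\<close> with probability \<open>p\<close> (\<open>stationary_diag_measure\<close>). The claimed recurrence is the balance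
  equation of this walk at the scales \<open>h \<ge> l\<close>; the equations at \<open>h < l\<close> are the initial condition.

  A walk reflected in this way has the law of the overall maximum of the free walk with steps \<open>+l\<close> and
  \<open>-k\<close> as stationary law. So \<open>b\<close> is obtained from \<open>tail n\<close>, the probability that the free walk
  started at \<open>0\<close> ever reaches level \<open>n\<close>, by \<open>b\<^sub>h = tail h - tail (h + 1)\<close>. For \<open>n > 0\<close>
  both \<open>tail\<close> and \<open>n \<mapsto> \<nu>\<^sup>n\<close> are harmonic for the walk, the latter because \<open>\<nu>\<close> is a root of the characteristic equation; the root in
  \<open>(0,1)\<close> exists because \<open>L > 0\<close> says that the free walk drifts to \<open>-\<infinity>\<close>.

  It remains to see that \<open>tail n / \<nu>\<^sup>n\<close> converges to a positive limit. Harmonic functions that vanish at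
  infinity satisfy a maximum principle (\<open>maximum_principle\<close>), so a bound \<open>c \<nu>\<^sup>n \<le> tail n\<close>
  on one window of \<open>l\<close> consecutive integers holds at all later ones. This bounds the
  ratio away from \<open>0\<close>. Along a sequence on which the ratio tends to its upper limit \<open>R\<close>, harmonicity
  forces the same at all positions shifted by \<open>k\<close> or \<open>-l\<close>, hence, as \<open>k\<close> and \<open>l\<close> are
  coprime, at all bounded shifts. There is thus a whole window on which the ratio exceeds \<open>R - \<delta>\<close>, and
  by the maximum principle it does so from there on (\<open>ratio_convergent\<close>).
\<close>

section \<open>The root of the characteristic equation\<close>

text \<open>The characteristic function vanishes at \<open>1\<close>, with positive slope exactly when the drift condition
  holds, and is positive at \<open>0\<close>; so it changes sign in \<open>(0,1)\<close>. Two roots there, together with the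
  root \<open>1\<close>, would give two critical points by Rolle's theorem, but there is only one on the
  positive axis.\<close>

lemma diag_root_unique:
  fixes p :: real and k l :: nat
  assumes p: "0 < p" "p < 1" and k: "k \<ge> 1" and l: "l \<ge> 1"
    and drift: "(1 - p) * real l < p * real k"
  shows "\<exists>!\<nu>. diag_root p k l \<nu>"
proof -
  define g where "g x = p * x ^ (k + l) - x ^ l + 1 - p" for x :: real
  define g' where "g' x = x ^ (l - 1) * (p * real (k + l) * x ^ k - real l)" for x :: real
  have g_deriv: "(g has_real_derivative g' x) (at x)" for x
  proof -
    have "(g has_real_derivative p * (real (k + l) * x ^ (k + l - 1)) - real l * x ^ (l - 1)) (at x)"
      unfolding g_def by (auto intro!: derivative_eq_intros)
    moreover have "x ^ (k + l - 1) = x ^ (l - 1) * x ^ k"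
      using l by (simp flip: power_add add: add.commute)
    ultimately show ?thesis
      by (simp add: g'_def algebra_simps)
  qed
  have g1: "g 1 = 0" by (simp add: g_def)
  have "g' 1 > 0" using drift by (simp add: g'_def algebra_simps)
  then obtain e where e: "e > 0" "\<And>h. h > 0 \<Longrightarrow> h < e \<Longrightarrow> g (1 - h) < g 1"
    using DERIV_pos_inc_left[OF g_deriv[of 1]] by blast
  define x where "x = 1 - min e 1 / 2"
  have x: "0 < x" "x < 1" using e(1) by (auto simp: x_def)
  have gx: "g x < 0" using e(1) e(2)[of "min e 1 / 2"] g1 by (auto simp: x_def)
  have g0: "g 0 > 0" using p l by (simp add: g_def power_0_left)
  have cont: "continuous_on S g" for S
    by (intro continuous_at_imp_continuous_on ballI DERIV_isCont[OF g_deriv])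
  have "\<exists>z. 0 \<le> z \<and> z \<le> x \<and> g z = 0"
    by (rule IVT2') (use x gx g0 cont in auto)
  then obtain z where z: "0 \<le> z" "z \<le> x" "g z = 0" by blast
  have "diag_root p k l z"
    using z x gx g0 by (auto simp: diag_root_def g_def less_le)
  moreover have False if "diag_root p k l a" "diag_root p k l b" "a < b" for a b
  proof -
    have ab: "0 < a" "b < 1" "g a = 0" "g b = 0" using that by (auto simp: diag_root_def g_def)
    have "\<exists>z>u. z < v \<and> g' z = 0" if "u < v" "g u = 0" "g v = 0" for u v
    proof -
      have "\<exists>z>u. z < v \<and> (*) (g' z) = (\<lambda>h. 0)"
        by (rule Rolle_deriv[OF that(1) _ cont])
           (use that g_deriv in \<open>auto simp: has_field_derivative_def\<close>)
      then show ?thesis by (metis mult.right_neutral)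
    qed
    from this[of a b] this[of b 1] obtain u v
      where uv: "a < u" "u < b" "g' u = 0" "b < v" "v < 1" "g' v = 0"
      using \<open>a < b\<close> ab g1 by blast
    have "u > 0" "v > 0" using uv ab by auto
    then have "p * real (k + l) * u ^ k = p * real (k + l) * v ^ k"
      using uv by (simp add: g'_def)
    then have "u ^ k = v ^ k" using p k by simp
    then have "u = v" using \<open>u > 0\<close> \<open>v > 0\<close> k by (simp add: power_eq_iff_eq_base)
    then show False using uv by simp
  qed
  ultimately show ?thesis by (metis linorder_neqE)
qed

section \<open>The probability that the walk reaches a level\<close>

text \<open>The walk on \<open>\<int>\<close> with steps \<open>+l\<close> (probability \<open>1 - p\<close>) and \<open>-k\<close> (probability \<open>p\<close>). It enters only
  through the harmonic functions below, in which \<open>n\<close> is the distance still to climb: a step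
  \<open>+l\<close> lowers \<open>n\<close> by \<open>l\<close>.\<close>

locale lattice_walk =
  fixes p \<nu> :: real and k l :: nat
  assumes p: "0 < p" "p < 1" and k: "k \<ge> 1" and l: "l \<ge> 1"
    and coprime: "coprime k l" and root: "diag_root p k l \<nu>"
begin

lemma \<nu>: "0 < \<nu>" "\<nu> < 1" "p * \<nu> ^ (k + l) + (1 - p) = \<nu> ^ l"
  using root by (auto simp: diag_root_def)

lemma power_harmonic:
  "\<nu> powi n = p * \<nu> powi (n + int k) + (1 - p) * \<nu> powi (n - int l)"
proof -
  have eq: "\<nu> powi n = \<nu> powi (n - int l) * \<nu> ^ l"
    "\<nu> powi (n + int k) = \<nu> powi (n - int l) * \<nu> ^ (k + l)"
    using \<nu>(1) power_int_add[of \<nu> "n - int l" "int l"] power_int_add[of \<nu> "n - int l" "int (k + l)"]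
    by (simp_all add: power_int_of_nat del: of_nat_add) (simp_all add: algebra_simps)
  show ?thesis unfolding eq \<nu>(3)[symmetric] by (simp add: algebra_simps)
qed

text \<open>The probability that the walk climbs a distance \<open>n\<close> within \<open>t\<close> steps, by conditioning on the first
  step.\<close>

fun reach :: "nat \<Rightarrow> int \<Rightarrow> real" where
  "reach 0 n = of_bool (n \<le> 0)"
| "reach (Suc t) n =
    (if n \<le> 0 then 1 else p * reach t (n + int k) + (1 - p) * reach t (n - int l))"

lemma reach_nonpos: "n \<le> 0 \<Longrightarrow> reach t n = 1"
  by (cases t) auto

lemma reach_nonneg: "0 \<le> reach t n"
  using p by (induction t arbitrary: n) auto

text \<open>Chernoff's bound: \<open>\<nu>\<^sup>n\<close> is harmonic everywhere and dominates the indicator of \<open>n \<le> 0\<close>, from which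
  the iteration starts.\<close>

lemma reach_le_power: "reach t n \<le> \<nu> powi n"
proof (induction t arbitrary: n)
  have base: "1 \<le> \<nu> powi n" if "n \<le> 0" for n
    using that \<nu> power_int_decreasing[of n 0 \<nu>] by auto
  case 0
  then show ?case using base \<nu> by auto
  case (Suc t)
  show ?case
  proof (cases "n \<le> 0")
    case False
    have "p * reach t (n + int k) + (1 - p) * reach t (n - int l) \<le>
       p * \<nu> powi (n + int k) + (1 - p) * \<nu> powi (n - int l)"
      using p Suc by (intro add_mono mult_left_mono) auto
    then show ?thesis using False power_harmonic[of n] by simp
  qed (use base in auto)
qed

lemma reach_le_one: "reach t n \<le> 1"
proof (cases "n \<le> 0")
  case False
  then show ?thesis
    using reach_le_power[of t n] power_int_decreasing[of 0 n \<nu>] \<nu> by auto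
qed (simp add: reach_nonpos)

lemma reach_mono: "reach t n \<le> reach (Suc t) n"
proof (induction t arbitrary: n)
  case 0
  then show ?case using reach_nonneg[of "Suc 0" n] by (cases "n \<le> 0") auto
next
  case (Suc t)
  then show ?case using p
    by (cases "n \<le> 0")
       (auto simp only: reach.simps if_True if_False intro!: add_mono mult_left_mono)
qed

lemma reach_antimono: "n \<le> m \<Longrightarrow> reach t m \<le> reach t n"
proof (induction t arbitrary: n m)
  case (Suc t)
  show ?case
  proof (cases "n \<le> 0")
    case True
    then show ?thesis using reach_le_one[of "Suc t" m] reach_nonpos[of n] by metis
  next
    case False
    then show ?thesis using p Suc by (auto intro!: add_mono mult_left_mono)
  qed
qed auto

definition tail :: "int \<Rightarrow> real" where
  "tail n = lim (\<lambda>t. reach t n)"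

lemma reach_tendsto_tail: "(\<lambda>t. reach t n) \<longlonglongrightarrow> tail n"
proof -
  have "incseq (\<lambda>t. reach t n)" by (intro incseq_SucI reach_mono)
  then have "convergent (\<lambda>t. reach t n)"
    by (rule incseq_convergent[where B = 1]) (auto simp: reach_le_one intro: convergentI)
  then show ?thesis by (simp add: tail_def convergent_LIMSEQ_iff)
qed

lemma tail_nonpos: "n \<le> 0 \<Longrightarrow> tail n = 1"
  by (simp add: tail_def reach_nonpos)

lemma tail_nonneg: "0 \<le> tail n"
  by (rule LIMSEQ_le_const[OF reach_tendsto_tail]) (simp add: reach_nonneg)

lemma tail_le_power: "tail n \<le> \<nu> powi n"
  by (rule LIMSEQ_le_const2[OF reach_tendsto_tail]) (simp add: reach_le_power)

lemma tail_antimono: "n \<le> m \<Longrightarrow> tail m \<le> tail n"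
  by (rule LIMSEQ_le[OF reach_tendsto_tail reach_tendsto_tail]) (simp add: reach_antimono)

lemma tail_harmonic:
  assumes "n > 0"
  shows "tail n = p * tail (n + int k) + (1 - p) * tail (n - int l)"
proof (rule LIMSEQ_unique)
  show "(\<lambda>t. reach (Suc t) n) \<longlonglongrightarrow> tail n"
    by (rule LIMSEQ_Suc[OF reach_tendsto_tail])
  show "(\<lambda>t. reach (Suc t) n) \<longlonglongrightarrow> p * tail (n + int k) + (1 - p) * tail (n - int l)"
    using assms by (auto intro!: tendsto_intros reach_tendsto_tail)
qed

lemma power_tendsto_zero: "(\<lambda>n. \<nu> powi int n) \<longlonglongrightarrow> 0"
  using \<nu> by (simp add: power_int_of_nat LIMSEQ_realpow_zero)

lemma tail_tendsto_zero: "(\<lambda>n. tail (int n)) \<longlonglongrightarrow> 0"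
  by (intro tendsto_sandwich[OF _ _ tendsto_const power_tendsto_zero] always_eventually allI
      tail_nonneg tail_le_power)

text \<open>A positive value would make \<open>d\<close> attain a positive maximum, because \<open>d\<close> vanishes at infinity. At the
  leftmost maximiser \<open>m > a\<close> the value is an average that involves the strictly smaller \<open>d (m - l)\<close>,
  which is absurd. The window of boundary values has length \<open>l\<close> so that the walk cannot jump over it.\<close>

lemma maximum_principle:
  fixes d :: "int \<Rightarrow> real"
  assumes harmonic: "\<And>n. n > a \<Longrightarrow> d n = p * d (n + int k) + (1 - p) * d (n - int l)"
    and boundary: "\<And>n. a - int l < n \<Longrightarrow> n \<le> a \<Longrightarrow> d n \<le> 0"
    and decay: "(\<lambda>n. d (int n)) \<longlonglongrightarrow> 0"
    and n: "n > a - int l"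
  shows "d n \<le> 0"
proof (rule ccontr)
  assume "\<not> d n \<le> 0"
  then have pos: "d n > 0" by simp
  obtain K where K: "\<And>i. i \<ge> K \<Longrightarrow> d (int i) < d n"
    using order_tendstoD(2)[OF decay pos] by (auto simp: eventually_sequentially)
  define S where "S = {a - int l<..max n (int K)}"
  have S: "finite S" "n \<in> S" using n by (auto simp: S_def)
  define D where "D = Max (d ` S)"
  have D: "D \<ge> d n" "D \<in> d ` S" using S by (auto simp: D_def intro!: Max_in)
  have le: "d i \<le> D" if "i > a - int l" for i
  proof (cases "i \<in> S")
    case False
    then have "i \<ge> int K" using that by (auto simp: S_def)
    then have "d i < d n" using K[of "nat i"] by simp
    then show ?thesis using D by simp
  qed (use S in \<open>auto simp: D_def\<close>)
  define m where "m = Min {i \<in> S. d i = D}"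
  have "m \<in> {i \<in> S. d i = D}" unfolding m_def using S D by (intro Min_in) auto
  then have m: "m \<in> S" "d m = D" by auto
  have ma: "m > a" using boundary[of m] m D pos by (force simp: S_def)
  have "d (m - int l) \<noteq> D"
  proof
    assume "d (m - int l) = D"
    then have "m - int l \<in> {i \<in> S. d i = D}" using ma m(1) by (auto simp: S_def)
    then have "m \<le> m - int l" unfolding m_def using S by (intro Min_le) auto
    then show False using l by simp
  qed
  then have "d (m - int l) < D" using le[of "m - int l"] ma by simp
  moreover have "d (m + int k) \<le> D" using le[of "m + int k"] ma by simp
  ultimately have "p * d (m + int k) + (1 - p) * d (m - int l) < p * D + (1 - p) * D"
    using p by (intro add_le_less_mono mult_left_mono mult_strict_left_mono) auto
  then show False using harmonic[OF ma] m by (simp add: algebra_simps)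
qed

text \<open>Since both sides tend to zero, a comparison on one window propagates to infinity.\<close>

lemma tail_ge_of_window:
  assumes a: "a \<ge> 0" and window: "\<And>n. a - int l < n \<Longrightarrow> n \<le> a \<Longrightarrow> c * \<nu> powi n \<le> tail n"
    and n: "n > a - int l"
  shows "c * \<nu> powi n \<le> tail n"
proof -
  have "c * \<nu> powi n - tail n \<le> 0"
  proof (rule maximum_principle[where a = a])
    fix n assume "n > a"
    then have "n > 0" using a by simp
    show "c * \<nu> powi n - tail n = p * (c * \<nu> powi (n + int k) - tail (n + int k)) +
         (1 - p) * (c * \<nu> powi (n - int l) - tail (n - int l))"
      unfolding tail_harmonic[OF \<open>n > 0\<close>] power_harmonic[of n] by (simp add: algebra_simps)
  next
    show "(\<lambda>n. c * \<nu> powi int n - tail (int n)) \<longlonglongrightarrow> 0"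
      using tendsto_diff[OF tendsto_mult_left[OF power_tendsto_zero, of c] tail_tendsto_zero] by simp
  qed (use n window in auto)
  then show ?thesis by simp
qed

section \<open>Exponential decay of the reaching probability\<close>

definition ratio :: "int \<Rightarrow> real" where
  "ratio n = tail n / \<nu> powi n"

lemma ratio_ge_iff: "c \<le> ratio n \<longleftrightarrow> c * \<nu> powi n \<le> tail n"
  using \<nu> by (simp add: ratio_def pos_le_divide_eq)

lemma ratio_le_one: "ratio n \<le> 1"
  using \<nu> tail_le_power[of n] by (simp add: ratio_def)

text \<open>On the window \<open>(-l, 0]\<close> the reaching probability is \<open>1\<close>, and \<open>\<nu>\<^sup>l\<^sup>+\<^sup>n \<le> 1\<close>.\<close>

lemma ratio_lower: "n > - int l \<Longrightarrow> \<nu> ^ l \<le> ratio n"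
  unfolding ratio_ge_iff
proof (rule tail_ge_of_window[where a = 0])
  fix n assume n: "0 - int l < n" "n \<le> 0"
  have "\<nu> ^ l * \<nu> powi n = \<nu> powi (int l + n)"
    using \<nu> by (simp add: power_int_add power_int_of_nat)
  also have "\<dots> \<le> 1"
    using \<nu> n power_int_decreasing[of 0 "int l + n" \<nu>] by auto
  finally show "\<nu> ^ l * \<nu> powi n \<le> tail n" using n by (simp add: tail_nonpos)
qed auto

text \<open>The exponentially tilted walk: dividing a harmonic function by \<open>\<nu>\<^sup>n\<close> turns the weights
  \<open>p\<close> and \<open>1 - p\<close> into \<open>q\<close> and \<open>1 - q\<close>.\<close>

definition q :: real where "q = p * \<nu> ^ k"

lemma q: "0 < q" "q < 1" "1 - q = (1 - p) / \<nu> ^ l"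
proof -
  show "0 < q" using p \<nu> by (simp add: q_def)
  show eq: "1 - q = (1 - p) / \<nu> ^ l"
    using \<nu> by (simp add: q_def field_simps power_add)
  have "0 < 1 - q" unfolding eq using p \<nu> by simp
  then show "q < 1" by simp
qed

lemma ratio_harmonic:
  assumes "n > 0"
  shows "ratio n = q * ratio (n + int k) + (1 - q) * ratio (n - int l)"
proof -
  have "q * ratio (n + int k) = p * tail (n + int k) / \<nu> powi n"
    using \<nu> by (simp add: ratio_def q_def power_int_add power_int_of_nat)
  moreover have "(1 - q) * ratio (n - int l) = (1 - p) * tail (n - int l) / \<nu> powi n"
    using \<nu> unfolding q(3) by (simp add: ratio_def power_int_diff power_int_of_nat)
  ultimately show ?thesis
    using tail_harmonic[OF assms] by (simp add: ratio_def add_divide_distrib)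
qed

lemma steps_reach_all: "\<exists>a b. x = int a * int k - int b * int l"
proof -
  have "\<exists>u v. u * int k + v * int l = gcd (int k) (int l)" by (rule bezout_int)
  then obtain u v where uv: "u * int k + v * int l = 1"
    using coprime by (auto simp: gcd_int_int_eq)
  \<comment> \<open>Adding a multiple of \<open>(l, k)\<close> to \<open>(x u, - x v)\<close> makes both coefficients nonnegative.\<close>
  define t where "t = \<bar>x * u\<bar> + \<bar>x * v\<bar>"
  have t: "t \<ge> \<bar>x * u\<bar>" "t \<ge> \<bar>x * v\<bar>" "t \<ge> 0" by (auto simp: t_def)
  have "t * 1 \<le> t * int l" "t * 1 \<le> t * int k" using k l t by (intro mult_left_mono; simp)+
  then have "x * u + t * int l \<ge> 0" "t * int k - x * v \<ge> 0" using t by linarith+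
  moreover have "x = (x * u + t * int l) * int k - (t * int k - x * v) * int l"
    using arg_cong[OF uv, of "\<lambda>w. x * w"] by (simp add: algebra_simps)
  ultimately have "x = int (nat (x * u + t * int l)) * int k - int (nat (t * int k - x * v)) * int l"
    by simp
  then show ?thesis by blast
qed

text \<open>A renewal theorem for the tilted walk, proved by hand. If an average of two numbers that are
  at most barely above the upper limit \<open>R\<close> is itself close to \<open>R\<close>, both numbers are close to \<open>R\<close>. Therefore
  closeness to \<open>R\<close> along a sequence of positions spreads to all their translates, and the maximum
  principle turns one window of good positions into a lower bound on a half-line.\<close>

lemma ratio_convergent: "\<exists>R>0. (\<lambda>n. ratio (int n)) \<longlonglongrightarrow> R"
proof -
  \<comment> \<open>The real number \<open>R\<close> is the upper limit of the ratio.\<close>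
  define X where "X = {c. \<exists>K. \<forall>n\<ge>K. ratio n \<le> c}"
  define R where "R = Inf X"
  have X1: "1 \<in> X" using ratio_le_one by (auto simp: X_def)
  have X0: "\<nu> ^ l \<le> c" if c: "c \<in> X" for c
  proof -
    obtain K where "\<forall>n\<ge>K. ratio n \<le> c" using c by (auto simp: X_def)
    then have "ratio (max K 0) \<le> c" by simp
    moreover have "max K 0 > - int l" using l by auto
    ultimately show ?thesis using ratio_lower by (meson order_trans)
  qed
  have bdd: "bdd_below X" using X0 by (auto simp: bdd_below_def)
  have "\<nu> ^ l \<le> R" unfolding R_def using X0 X1 by (intro cInf_greatest) auto
  then have Rpos: "R > 0" using zero_less_power[OF \<nu>(1), of l] by linarith
  have upper: "\<exists>K. \<forall>n\<ge>K. ratio n \<le> R + \<delta>" if \<delta>: "\<delta> > 0" for \<delta>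
  proof -
    obtain c where "c \<in> X" "c < R + \<delta>"
      using cInf_lessD[of X "R + \<delta>"] X1 \<delta> by (auto simp: R_def)
    then show ?thesis by (force simp: X_def)
  qed
  have lower: "\<exists>n\<ge>K. ratio n > R - \<delta>" if \<delta>: "\<delta> > 0" for \<delta> K
  proof -
    have "R - \<delta> \<notin> X" using cInf_lower[OF _ bdd, of "R - \<delta>"] \<delta> by (auto simp: R_def)
    then show ?thesis by (auto simp: X_def not_le)
  qed
  have "\<exists>s. \<forall>i::nat. s i \<ge> int i \<and> ratio (s i) > R - 1 / real (Suc i)"
    by (rule choice) (use lower in auto)
  then obtain s where s: "\<And>i. s i \<ge> int i" "\<And>i. ratio (s i) > R - 1 / real (Suc i)"
    by blast
  have s_large: "\<forall>\<^sub>F i in sequentially. s i \<ge> K" for K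
    using eventually_ge_at_top[of "nat K"] by eventually_elim (metis nat_le_iff order_trans s(1))
  \<comment> \<open>Positions \<open>s i + x\<close> at which the ratio is asymptotically at least \<open>R\<close>.\<close>
  define near where "near x \<longleftrightarrow> (\<forall>\<delta>>0. \<forall>\<^sub>F i in sequentially. ratio (s i + x) > R - \<delta>)" for x
  have near0: "near 0"
    unfolding near_def
  proof (intro allI impI)
    fix \<delta> :: real assume "\<delta> > 0"
    have "(\<lambda>i. R - 1 / real (Suc i)) \<longlonglongrightarrow> R - 0"
      by (intro tendsto_intros LIMSEQ_Suc[OF lim_1_over_n])
    then have "\<forall>\<^sub>F i in sequentially. R - 1 / real (Suc i) > R - \<delta>"
      by (rule order_tendstoD) (use \<open>\<delta> > 0\<close> in simp)
    then show "\<forall>\<^sub>F i in sequentially. ratio (s i + 0) > R - \<delta>"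
    proof eventually_elim
      case (elim i)
      then show ?case using s(2)[of i] by simp
    qed
  qed
  have near_step: "near (x + int k) \<and> near (x - int l)" if x: "near x" for x
    unfolding near_def
  proof (intro conjI allI impI)
    fix \<delta> :: real assume \<delta>: "\<delta> > 0"
    \<comment> \<open>Small enough that a deviation \<open>\<eta>\<close> of the average and of one term, each weighted, moves the
      other term by less than \<open>\<delta>\<close>; the factor 2 bounds \<open>1 + q\<close> and \<open>2 - q\<close>.\<close>
    define \<eta> where "\<eta> = \<delta> * min q (1 - q) / 2"
    have "\<delta> * min q (1 - q) \<le> \<delta> * q" "\<delta> * min q (1 - q) \<le> \<delta> * (1 - q)"
      using \<delta> by (auto intro!: mult_left_mono simp del: mult_le_cancel_left_pos)
    then have \<eta>: "\<eta> > 0" "2 * \<eta> \<le> \<delta> * q" "2 * \<eta> \<le> \<delta> * (1 - q)"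
      using \<delta> q(1,2) by (auto simp: \<eta>_def)
    obtain K where K: "\<And>n. n \<ge> K \<Longrightarrow> ratio n \<le> R + \<eta>" using upper[OF \<eta>(1)] by blast
    have ev: "\<forall>\<^sub>F i in sequentially. ratio (s i + x) > R - \<eta> \<and> s i \<ge> max 1 K - x + int l"
      using x \<eta>(1) s_large by (auto simp: near_def intro: eventually_conj)
    have both: "R - \<delta> < ratio (n + int k) \<and> R - \<delta> < ratio (n - int l)"
      if n: "ratio n > R - \<eta>" "n \<ge> max 1 K + int l" for n
    proof -
      let ?u = "ratio (n + int k)" and ?v = "ratio (n - int l)"
      have eq: "q * ?u + (1 - q) * ?v > R - \<eta>" using ratio_harmonic[of n] n by simp
      have "?u \<le> R + \<eta>" "?v \<le> R + \<eta>" using K n by auto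
      then have "q * ?u \<le> q * (R + \<eta>)" "(1 - q) * ?v \<le> (1 - q) * (R + \<eta>)"
        using q(1,2) by (auto intro!: mult_left_mono simp del: mult_le_cancel_left_pos)
      moreover have "q * \<eta> > 0" "q * \<eta> < \<eta>" using q(1,2) \<eta> by auto
      ultimately have "q * (R - \<delta>) < q * ?u" "(1 - q) * (R - \<delta>) < (1 - q) * ?v"
        using eq \<eta> by (simp_all only: algebra_simps)
      then show ?thesis using q(1,2) by auto
    qed
    show "\<forall>\<^sub>F i in sequentially. ratio (s i + (x + int k)) > R - \<delta>"
      using ev
    proof eventually_elim
      case (elim i)
      then show ?case using both[of "s i + x"] by (simp add: algebra_simps)
    qed
    show "\<forall>\<^sub>F i in sequentially. ratio (s i + (x - int l)) > R - \<delta>"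
      using ev
    proof eventually_elim
      case (elim i)
      then show ?case using both[of "s i + x"] by (simp add: algebra_simps)
    qed
  qed
  have near_up: "near (int a * int k)" for a
  proof (induction a)
    case (Suc a)
    then show ?case using near_step[of "int a * int k"] by (simp add: algebra_simps)
  qed (simp add: near0)
  have near_grid: "near (int a * int k - int b * int l)" for a b
  proof (induction b)
    case (Suc b)
    then show ?case using near_step[of "int a * int k - int b * int l"] by (simp add: algebra_simps)
  qed (simp add: near_up)
  have near_all: "near x" for x using steps_reach_all[of x] near_grid by metis
  have eventually_ge: "\<exists>K. \<forall>n\<ge>K. ratio n \<ge> R - \<delta>" if \<delta>: "\<delta> > 0" for \<delta>
  proof -
    have "\<forall>\<^sub>F i in sequentially. \<forall>x\<in>{- int l<..0}. ratio (s i + x) > R - \<delta>"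
      using near_all \<delta> by (intro eventually_ball_finite) (auto simp: near_def)
    then have "\<forall>\<^sub>F i in sequentially. s i \<ge> 0 \<and> (\<forall>x\<in>{- int l<..0}. ratio (s i + x) > R - \<delta>)"
      using s_large[of 0] by (rule eventually_conj[rotated])
    then obtain i where i: "s i \<ge> 0" "\<And>x. x \<in> {- int l<..0} \<Longrightarrow> ratio (s i + x) > R - \<delta>"
      by (auto dest!: eventually_happens)
    have "(R - \<delta>) * \<nu> powi n \<le> tail n" if "n \<ge> s i" for n
    proof (rule tail_ge_of_window[OF i(1)])
      fix n assume "s i - int l < n" "n \<le> s i"
      then show "(R - \<delta>) * \<nu> powi n \<le> tail n"
        using i(2)[of "n - s i"] by (simp flip: ratio_ge_iff)
    qed (use that l in auto)
    then show ?thesis by (auto simp: ratio_ge_iff)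
  qed
  have "(\<lambda>n. ratio (int n)) \<longlonglongrightarrow> R"
  proof (rule LIMSEQ_I)
    fix e :: real assume e: "e > 0"
    obtain K L where KL: "\<And>n. n \<ge> K \<Longrightarrow> ratio n \<le> R + e / 2" "\<And>n. n \<ge> L \<Longrightarrow> ratio n \<ge> R - e / 2"
      using upper[of "e/2"] eventually_ge[of "e/2"] e by auto
    have "norm (ratio (int n) - R) < e" if "n \<ge> nat (max K L)" for n
    proof -
      have "K \<le> int n" "L \<le> int n" using that by (simp_all add: nat_le_iff)
      then show ?thesis using KL(1)[of "int n"] KL(2)[of "int n"] e by (simp add: abs_real_def)
    qed
    then show "\<exists>n0. \<forall>n\<ge>n0. norm (ratio (int n) - R) < e" by blast
  qed
  then show ?thesis using Rpos by blast
qed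

text \<open>The law of the overall maximum of the free walk started at \<open>0\<close>.\<close>

definition weight :: "nat \<Rightarrow> real" where
  "weight h = tail (int h) - tail (int h + 1)"

lemma weight_nonneg: "0 \<le> weight h"
  by (simp add: weight_def tail_antimono)

lemma weight_ratio_limit: "\<exists>c>0. (\<lambda>h. weight h / \<nu> ^ h) \<longlonglongrightarrow> c"
proof -
  obtain R where R: "R > 0" "(\<lambda>n. ratio (int n)) \<longlonglongrightarrow> R" using ratio_convergent by blast
  have "weight h / \<nu> ^ h = ratio (int h) - \<nu> * ratio (int (Suc h))" for h
    using \<nu> by (simp add: weight_def ratio_def diff_divide_distrib power_int_add power_int_of_nat
      add.commute[of 1])
  moreover have "(\<lambda>h. ratio (int h) - \<nu> * ratio (int (Suc h))) \<longlonglongrightarrow> R - \<nu> * R"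
    by (intro tendsto_intros R LIMSEQ_Suc[OF R(2)])
  moreover have "R - \<nu> * R > 0" using R \<nu> by simp
  ultimately show ?thesis by (intro exI[of _ "R - \<nu> * R"] conjI) (simp_all only:)
qed

text \<open>For \<open>h > 0\<close> this is the difference of the harmonicity equations at \<open>h\<close> and \<open>h + 1\<close>; when \<open>h < l\<close>
  the two terms one step up both equal \<open>1\<close> and cancel. At \<open>h = 0\<close>, where \<open>tail\<close> is not harmonic,
  it is the equation at \<open>1\<close> after telescoping the sum of the weights.\<close>

lemma weight_balance:
  "weight h = p * (weight (h + k) + (if h = 0 then \<Sum>j<k. weight j else 0)) +
     (1 - p) * (if l \<le> h then weight (h - l) else 0)"
proof (cases "h = 0")
  case True
  have sum: "(\<Sum>j<n. weight j) = 1 - tail (int n)" for n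
    by (induction n) (auto simp: weight_def tail_nonpos algebra_simps)
  have "tail 1 = p * tail (1 + int k) + (1 - p)"
    using tail_harmonic[of 1] l by (simp add: tail_nonpos)
  then show ?thesis
    using True l unfolding sum by (simp add: weight_def tail_nonpos algebra_simps)
next
  case False
  have h: "weight h = p * weight (h + k) +
      (1 - p) * (tail (int h - int l) - tail (int h + 1 - int l))"
    using tail_harmonic[of "int h"] tail_harmonic[of "int h + 1"] False
    by (simp add: weight_def algebra_simps)
  show ?thesis
  proof (cases "l \<le> h")
    case True
    then show ?thesis using h False by (simp add: weight_def of_nat_diff algebra_simps)
  next
    case not_le: False
    then have "tail (int h - int l) = 1" "tail (int h + 1 - int l) = 1"
      by (auto intro!: tail_nonpos)
    then show ?thesis using h False not_le by simp
  qed
qed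

lemma weight_recurrence:
  "weight (j + k + l) = 1 / p * weight (j + l) - (1 - p) / p * weight j"
  using weight_balance[of "j + l"] p l by (simp add: field_simps)

end

section \<open>The two-point maps on diagonal squares\<close>

lemma emeasure_lborel_vimage_affine:
  fixes t :: "real \<times> real"
  assumes c: "c > 0" and B: "B \<in> sets borel"
  shows "emeasure lborel ((\<lambda>z. t + c *\<^sub>R z) -` B) = ennreal (1 / c\<^sup>2) * emeasure lborel B"
proof -
  let ?S = "\<lambda>z. t + c *\<^sub>R z"
  have "emeasure lborel B = emeasure (density (distr lborel borel ?S) (\<lambda>_. ennreal (\<bar>c\<bar> ^ DIM(real \<times> real)))) B"
    using lborel_affine[of c t] c by simp
  also have "\<dots> = ennreal (c\<^sup>2) * emeasure lborel (?S -` B)"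
    using c B by (simp add: emeasure_density nn_integral_cmult_indicator emeasure_distr power2_eq_square)
  finally have "ennreal (1 / c\<^sup>2) * emeasure lborel B =
      (ennreal (1 / c\<^sup>2) * ennreal (c\<^sup>2)) * emeasure lborel (?S -` B)"
    by (simp add: mult.assoc)
  also have "ennreal (1 / c\<^sup>2) * ennreal (c\<^sup>2) = 1"
    using c by (simp flip: ennreal_mult)
  finally show ?thesis by simp
qed

lemma sets_borel_vimage_affine:
  fixes t :: "real \<times> real"
  assumes "B \<in> sets borel"
  shows "(\<lambda>z. t + c *\<^sub>R z) -` B \<in> sets borel"
  using measurable_sets[of "\<lambda>z. t + c *\<^sub>R z" borel borel B] assms by simp

lemma unit_square_borel [measurable]: "unit_square \<in> sets borel"
  unfolding unit_square_def by (intro borel_Times) auto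

lemma diag_square_borel [measurable]: "diag_square \<kappa> h j \<in> sets borel"
  unfolding diag_square_def by (intro borel_Times) auto

lemma mem_diag_square_iff:
  assumes "\<kappa> > 0"
  shows "(x, y) \<in> diag_square \<kappa> h j \<longleftrightarrow>
    real j \<le> real \<kappa> ^ h * x \<and> real \<kappa> ^ h * x < real j + 1 \<and>
    real j \<le> real \<kappa> ^ h * y \<and> real \<kappa> ^ h * y < real j + 1"
  using assms by (auto simp: diag_square_def pos_divide_le_eq pos_less_divide_eq mult.commute)

lemma digit_bounds:
  fixes x :: real
  assumes "j < \<kappa> ^ h" "\<kappa> > 0" "real j \<le> real \<kappa> ^ h * x" "real \<kappa> ^ h * x < real j + 1"
  shows "0 \<le> x \<and> x < 1"
proof -
  have pos: "real \<kappa> ^ h > 0" using assms by simp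
  have "real j + 1 \<le> real (\<kappa> ^ h)" using assms(1) by linarith
  then have "real \<kappa> ^ h * x < real \<kappa> ^ h * 1" using assms(4) by simp
  moreover have "real \<kappa> ^ h * 0 \<le> real \<kappa> ^ h * x" using assms(3) by simp
  ultimately show ?thesis using pos by (simp only: mult_le_cancel_left_pos mult_less_cancel_left_pos)
qed

lemma diag_square_subset: "j < \<kappa> ^ h \<Longrightarrow> \<kappa> > 0 \<Longrightarrow> diag_square \<kappa> h j \<subseteq> unit_square"
  using digit_bounds[of j \<kappa> h]
  by (auto simp: mem_diag_square_iff unit_square_def)

lemma two_point_map_measurable [measurable]: "two_point_map N M i \<in> borel_measurable borel"
proof -
  have f: "ifs_map N M i \<in> borel_measurable borel"
    unfolding ifs_map_def frac_def by (cases "i = 0") (simp_all, measurable)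
  have proj: "fst \<in> borel_measurable (borel :: (real \<times> real) measure)"
    "snd \<in> borel_measurable (borel :: (real \<times> real) measure)"
    by (intro borel_measurable_continuous_onI continuous_intros)+
  have "(\<lambda>z. (ifs_map N M i (fst z), ifs_map N M i (snd z)))
      \<in> borel_measurable (borel :: (real \<times> real) measure)"
    by (intro borel_measurable_Pair measurable_compose[OF proj(1) f] measurable_compose[OF proj(2) f])
  then show ?thesis by (simp add: two_point_map_def map_prod_def case_prod_beta')
qed

lemma two_point_map_unit_square:
  assumes "z \<in> unit_square" "i \<le> M"
  shows "two_point_map N M i z \<in> unit_square"
proof -
  have "0 \<le> ifs_map N M i x \<and> ifs_map N M i x < 1" if "0 \<le> x" "x < 1" for x
    using that assms(2) by (auto simp: ifs_map_def frac_lt_1 pos_divide_less_eq)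
  then show ?thesis using assms(1) by (auto simp: unit_square_def two_point_map_def)
qed

text \<open>Preimages are taken inside the square, as for maps \<open>[0,1)\<^sup>2 \<rightarrow> [0,1)\<^sup>2\<close>.\<close>

definition pull :: "nat \<Rightarrow> nat \<Rightarrow> nat \<Rightarrow> (real \<times> real) set \<Rightarrow> (real \<times> real) set" where
  "pull N M i A = {z \<in> unit_square. two_point_map N M i z \<in> A}"

lemma pull_borel: "A \<in> sets borel \<Longrightarrow> pull N M i A \<in> sets borel"
proof -
  assume "A \<in> sets borel"
  then have "two_point_map N M i -` A \<inter> space borel \<in> sets borel"
    by (intro measurable_sets[OF two_point_map_measurable])
  moreover have "pull N M i A = unit_square \<inter> (two_point_map N M i -` A \<inter> space borel)"
    by (auto simp: pull_def)
  ultimately show ?thesis by simp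
qed

lemma pull_subset: "pull N M i A \<subseteq> unit_square"
  by (auto simp: pull_def)

lemma pull_eq_vimage: "pull N M i A = two_point_map N M i -` A \<inter> unit_square"
  by (auto simp: pull_def)

lemma ifs_map_0_power_Suc: "ifs_map (\<kappa> ^ Suc n) M 0 x = ifs_map (\<kappa> ^ n) M 0 (ifs_map \<kappa> M 0 x)"
proof -
  have "real \<kappa> ^ Suc n * x = real \<kappa> ^ n * frac (real \<kappa> * x) + of_int (int (\<kappa> ^ n) * \<lfloor>real \<kappa> * x\<rfloor>)"
    by (simp only: frac_def power_Suc of_int_mult of_int_of_nat_eq of_nat_power right_diff_distrib) simp
  then have "frac (real \<kappa> ^ Suc n * x) = frac (real \<kappa> ^ n * frac (real \<kappa> * x))"
    by (simp only: frac_add_of_int_right)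
  then show ?thesis by (simp only: ifs_map_def of_nat_power if_True simp_thms)
qed

text \<open>The expansion by \<open>\<kappa>\<^sup>n\<close> is the \<open>n\<close>-th iterate of the expansion by \<open>\<kappa>\<close>, so that only a single step
  between consecutive scales has to be computed.\<close>

lemma pull_0_power_Suc: "pull (\<kappa> ^ Suc n) M 0 A = pull \<kappa> M 0 (pull (\<kappa> ^ n) M 0 A)"
proof -
  have "two_point_map (\<kappa> ^ Suc n) M 0 z = two_point_map (\<kappa> ^ n) M 0 (two_point_map \<kappa> M 0 z)" for z
    by (cases z) (simp only: two_point_map_def map_prod_simp ifs_map_0_power_Suc)
  then show ?thesis
    using two_point_map_unit_square[of _ 0 M \<kappa>] by (auto simp only: pull_def mem_Collect_eq)
qed

text \<open>The measure \<open>\<mu>\<^sub>h\<close>, of total mass \<open>\<kappa>\<^sup>h \<cdot> \<kappa>\<^sup>h \<cdot> \<kappa>\<^sup>-\<^sup>2\<^sup>h = 1\<close>, as a set function.\<close>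

definition diag_avg :: "nat \<Rightarrow> nat \<Rightarrow> (real \<times> real) set \<Rightarrow> ennreal" where
  "diag_avg \<kappa> h A = (\<Sum>j<\<kappa> ^ h. ennreal (real \<kappa> ^ h) * emeasure lborel (diag_square \<kappa> h j \<inter> A))"

lemma sum_blocks:
  fixes F :: "nat \<Rightarrow> 'a :: comm_monoid_add"
  shows "(\<Sum>a<n. \<Sum>j<k. F (a * k + j)) = (\<Sum>j<n * k. F j)"
proof -
  have "(\<Sum>j<k. F (a * k + j)) = sum F {a * k..<a * k + k}" for a
    using sum.shift_bounds_nat_ivl[of F 0 "a * k" k]
    by (simp add: atLeast0LessThan add.commute)
  then show ?thesis by (simp add: sum.nat_group)
qed

text \<open>The contraction number \<open>Suc i\<close> maps the square number \<open>j\<close> at scale \<open>h\<close> onto the square number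
  \<open>i \<kappa>\<^sup>h + j\<close> at scale \<open>h + l\<close>.\<close>

lemma diag_square_pull_contraction:
  assumes \<kappa>: "\<kappa> > 0" and i: "i < \<kappa> ^ l" and j: "j < \<kappa> ^ h"
  shows "diag_square \<kappa> h j \<inter> pull N (\<kappa> ^ l) (Suc i) A =
    (\<lambda>z. (real i / real \<kappa> ^ l, real i / real \<kappa> ^ l) + (1 / real \<kappa> ^ l) *\<^sub>R z) -`
      (diag_square \<kappa> (h + l) (i * \<kappa> ^ h + j) \<inter> A)"
proof -
  let ?s = "\<lambda>x. real i / real \<kappa> ^ l + 1 / real \<kappa> ^ l * x"
  have scale: "real \<kappa> ^ (h + l) * ?s x = real i * real \<kappa> ^ h + real \<kappa> ^ h * x" for x
    using \<kappa> by (simp add: power_add field_simps)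
  have square: "(x, y) \<in> diag_square \<kappa> h j \<longleftrightarrow> (?s x, ?s y) \<in> diag_square \<kappa> (h + l) (i * \<kappa> ^ h + j)" for x y
    unfolding mem_diag_square_iff[OF \<kappa>] scale by auto
  have map: "two_point_map N (\<kappa> ^ l) (Suc i) (x, y) = (?s x, ?s y)" for x y
    by (simp add: two_point_map_def ifs_map_def add_divide_distrib add.commute)
  have "(x, y) \<in> diag_square \<kappa> h j \<inter> pull N (\<kappa> ^ l) (Suc i) A \<longleftrightarrow>
      (?s x, ?s y) \<in> diag_square \<kappa> (h + l) (i * \<kappa> ^ h + j) \<inter> A" for x y
    using square[of x y] diag_square_subset[OF j \<kappa>] by (auto simp: pull_def map)
  then show ?thesis by (intro set_eqI) (simp add: split_paired_all)
qed

text \<open>Every diagonal square at scale \<open>h + l\<close> is the image of exactly one square at scale \<open>h\<close> under exactly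
  one contraction. The Jacobian \<open>\<kappa>\<^sup>2\<^sup>l\<close> of its inverse, the factor \<open>1/M\<close> and the normalisation
  \<open>\<kappa>\<^sup>h\<close> combine to \<open>\<kappa>\<^sup>h\<^sup>+\<^sup>l\<close>.\<close>

lemma diag_avg_contractions:
  assumes \<kappa>: "\<kappa> > 0" and A: "A \<in> sets borel"
  shows "(\<Sum>i<\<kappa> ^ l. ennreal (1 / real \<kappa> ^ l) * diag_avg \<kappa> h (pull N (\<kappa> ^ l) (Suc i) A)) =
    diag_avg \<kappa> (h + l) A"
proof -
  let ?M = "real \<kappa> ^ l"
  have M: "?M > 0" using \<kappa> by simp
  have "ennreal (1 / ?M) * diag_avg \<kappa> h (pull N (\<kappa> ^ l) (Suc i) A) =
    (\<Sum>j<\<kappa> ^ h. ennreal (real \<kappa> ^ (h + l)) * emeasure lborel (diag_square \<kappa> (h + l) (i * \<kappa> ^ h + j) \<inter> A))"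
    if i: "i < \<kappa> ^ l" for i
    unfolding diag_avg_def sum_distrib_left
  proof (rule sum.cong[OF refl])
    fix j assume "j \<in> {..<\<kappa> ^ h}"
    then have j: "j < \<kappa> ^ h" by simp
    have "emeasure lborel (diag_square \<kappa> h j \<inter> pull N (\<kappa> ^ l) (Suc i) A) =
      ennreal (1 / (1 / ?M)\<^sup>2) * emeasure lborel (diag_square \<kappa> (h + l) (i * \<kappa> ^ h + j) \<inter> A)"
      unfolding diag_square_pull_contraction[OF \<kappa> i j]
      using M A by (intro emeasure_lborel_vimage_affine) auto
    moreover have "ennreal (1 / ?M) * (ennreal (real \<kappa> ^ h) * ennreal (1 / (1 / ?M)\<^sup>2)) =
        ennreal (real \<kappa> ^ (h + l))"
      using M by (simp flip: ennreal_mult) (simp add: power2_eq_square power_add)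
    ultimately show "ennreal (1 / ?M) * (ennreal (real \<kappa> ^ h) *
        emeasure lborel (diag_square \<kappa> h j \<inter> pull N (\<kappa> ^ l) (Suc i) A)) =
      ennreal (real \<kappa> ^ (h + l)) * emeasure lborel (diag_square \<kappa> (h + l) (i * \<kappa> ^ h + j) \<inter> A)"
      by (metis mult.assoc)
  qed
  then have "(\<Sum>i<\<kappa> ^ l. ennreal (1 / ?M) * diag_avg \<kappa> h (pull N (\<kappa> ^ l) (Suc i) A)) =
    (\<Sum>i<\<kappa> ^ l. \<Sum>j<\<kappa> ^ h. ennreal (real \<kappa> ^ (h + l)) * emeasure lborel (diag_square \<kappa> (h + l) (i * \<kappa> ^ h + j) \<inter> A))"
    by (intro sum.cong) auto
  also have "\<dots> = diag_avg \<kappa> (h + l) A"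
    unfolding diag_avg_def
    by (subst sum_blocks[where F = "\<lambda>j. ennreal (real \<kappa> ^ (h + l)) * emeasure lborel (diag_square \<kappa> (h + l) j \<inter> A)"])
       (simp add: power_add mult.commute)
  finally show ?thesis .
qed

lemma frac_eq_diff:
  assumes "0 \<le> u - real a" "u - real a < 1"
  shows "frac u = u - real a"
  using assms by (simp add: frac_unique_iff)

text \<open>On a diagonal square of scale at least \<open>1\<close> the expansion has no discontinuity: both coordinates have
  the same leading digit \<open>a\<close> in base \<open>\<kappa>\<close>, and it is this digit that the map deletes.\<close>

lemma diag_square_pull_expansion:
  assumes \<kappa>: "\<kappa> > 0" and a: "a < \<kappa>" and j: "j < \<kappa> ^ h"
  shows "diag_square \<kappa> (Suc h) (a * \<kappa> ^ h + j) \<inter> pull \<kappa> M 0 A =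
    (\<lambda>z. (- real a, - real a) + real \<kappa> *\<^sub>R z) -` (diag_square \<kappa> h j \<inter> A)"
proof -
  have index: "a * \<kappa> ^ h + j < \<kappa> ^ Suc h"
  proof -
    have "a * \<kappa> ^ h + j < Suc a * \<kappa> ^ h" using j by simp
    also have "\<dots> \<le> \<kappa> * \<kappa> ^ h" using a by (intro mult_right_mono) auto
    finally show ?thesis by simp
  qed
  have scale: "real \<kappa> ^ h * (- real a + real \<kappa> * x) = real \<kappa> ^ Suc h * x - real a * real \<kappa> ^ h" for x
    by (simp add: algebra_simps)
  have iff: "(x, y) \<in> diag_square \<kappa> (Suc h) (a * \<kappa> ^ h + j) \<longleftrightarrow>
      (- real a + real \<kappa> * x, - real a + real \<kappa> * y) \<in> diag_square \<kappa> h j" for x y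
    unfolding mem_diag_square_iff[OF \<kappa>] scale by auto
  have frac: "frac (real \<kappa> * x) = - real a + real \<kappa> * x \<and> frac (real \<kappa> * y) = - real a + real \<kappa> * y"
    if "(- real a + real \<kappa> * x, - real a + real \<kappa> * y) \<in> diag_square \<kappa> h j" for x y
  proof -
    have "(- real a + real \<kappa> * x, - real a + real \<kappa> * y) \<in> unit_square"
      using that diag_square_subset[OF j \<kappa>] by blast
    then show ?thesis
      using frac_eq_diff[of "real \<kappa> * x" a] frac_eq_diff[of "real \<kappa> * y" a]
      by (auto simp: unit_square_def)
  qed
  have "(x, y) \<in> diag_square \<kappa> (Suc h) (a * \<kappa> ^ h + j) \<inter> pull \<kappa> M 0 A \<longleftrightarrow>
    (- real a + real \<kappa> * x, - real a + real \<kappa> * y) \<in> diag_square \<kappa> h j \<inter> A" for x y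
    using iff[of x y] frac[of x y] diag_square_subset[OF index \<kappa>]
    by (auto simp: pull_def two_point_map_def ifs_map_def)
  then show ?thesis by (intro set_eqI) (simp add: split_paired_all)
qed

text \<open>The expansion maps \<open>\<kappa>\<close> squares at scale \<open>h + 1\<close>, one for each leading digit, onto each square at scale
  \<open>h\<close>.\<close>

lemma diag_avg_expansion_Suc:
  assumes \<kappa>: "\<kappa> > 0" and A: "A \<in> sets borel"
  shows "diag_avg \<kappa> (Suc h) (pull \<kappa> M 0 A) = diag_avg \<kappa> h A"
proof -
  let ?Q = "\<lambda>j. ennreal (real \<kappa> ^ Suc h) * emeasure lborel (diag_square \<kappa> (Suc h) j \<inter> pull \<kappa> M 0 A)"
  let ?R = "\<lambda>j. ennreal (real \<kappa> ^ h) * emeasure lborel (diag_square \<kappa> h j \<inter> A)"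
  have step: "?Q (a * \<kappa> ^ h + j) = ennreal (1 / real \<kappa>) * ?R j"
    if a: "a < \<kappa>" and j: "j < \<kappa> ^ h" for a j
  proof -
    have "emeasure lborel (diag_square \<kappa> (Suc h) (a * \<kappa> ^ h + j) \<inter> pull \<kappa> M 0 A) =
      ennreal (1 / (real \<kappa>)\<^sup>2) * emeasure lborel (diag_square \<kappa> h j \<inter> A)"
      unfolding diag_square_pull_expansion[OF \<kappa> a j]
      using \<kappa> A by (intro emeasure_lborel_vimage_affine) auto
    moreover have "ennreal (real \<kappa> ^ Suc h) * ennreal (1 / (real \<kappa>)\<^sup>2) =
        ennreal (1 / real \<kappa>) * ennreal (real \<kappa> ^ h)"
      using \<kappa> by (simp flip: ennreal_mult add: power2_eq_square)
    ultimately show ?thesis by (metis mult.assoc)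
  qed
  have "diag_avg \<kappa> (Suc h) (pull \<kappa> M 0 A) = (\<Sum>a<\<kappa>. \<Sum>j<\<kappa> ^ h. ?Q (a * \<kappa> ^ h + j))"
    by (subst sum_blocks[where F = ?Q]) (simp add: diag_avg_def)
  also have "\<dots> = (\<Sum>a<\<kappa>. \<Sum>j<\<kappa> ^ h. ennreal (1 / real \<kappa>) * ?R j)"
    by (intro sum.cong refl step) auto
  also have "\<dots> = of_nat \<kappa> * ennreal (1 / real \<kappa>) * diag_avg \<kappa> h A"
    by (simp add: diag_avg_def mult.assoc flip: sum_distrib_left)
  also have "of_nat \<kappa> * ennreal (1 / real \<kappa>) = ennreal (real \<kappa> * (1 / real \<kappa>))"
    by (simp only: ennreal_of_nat_eq_real_of_nat flip: ennreal_mult')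
  also have "\<dots> = 1" using \<kappa> by simp
  finally show ?thesis by simp
qed

lemma diag_avg_0: "A \<subseteq> unit_square \<Longrightarrow> diag_avg \<kappa> 0 A = emeasure lborel A"
  by (simp add: diag_avg_def diag_square_def flip: unit_square_def) (simp add: Int_absorb1)

text \<open>At scale \<open>0\<close> this is the invariance of Lebesgue measure under the expansion: the square splits into
  \<open>\<kappa>\<^sup>2\<close> cells indexed by the leading digits \<open>(a, c)\<close> of the two coordinates, which may now differ, and
  each cell is mapped affinely onto the whole square.\<close>

lemma diag_avg_expansion_0:
  assumes \<kappa>: "\<kappa> > 0" and A: "A \<in> sets borel" "A \<subseteq> unit_square"
  shows "diag_avg \<kappa> 0 (pull \<kappa> M 0 A) = diag_avg \<kappa> 0 A"
proof -
  define S where "S = (\<lambda>(a, c) z. (- real a, - real c) + real \<kappa> *\<^sub>R z)"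
  let ?I = "{..<\<kappa>} \<times> {..<\<kappa>}"
  have fr: "\<exists>a<\<kappa>. frac (real \<kappa> * x) = real \<kappa> * x - real a" if x: "0 \<le> x" "x < 1" for x
  proof -
    define a where "a = nat \<lfloor>real \<kappa> * x\<rfloor>"
    have "real \<kappa> * x < real \<kappa>" "0 \<le> real \<kappa> * x" using x \<kappa> by auto
    then have "a < \<kappa>" "real a = of_int \<lfloor>real \<kappa> * x\<rfloor>" unfolding a_def by linarith+
    then show ?thesis by (auto simp: frac_def)
  qed
  have fr': "0 \<le> x \<and> x < 1 \<and> frac (real \<kappa> * x) = real \<kappa> * x - real a"
    if a: "a < \<kappa>" "0 \<le> real \<kappa> * x - real a" "real \<kappa> * x - real a < 1" for a x
  proof -
    have "real a + 1 \<le> real \<kappa>" using a(1) by linarith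
    then have "0 \<le> real \<kappa> * x" "real \<kappa> * x < real \<kappa>" using a(2,3) by linarith+
    then have "0 \<le> x" "x < 1" using \<kappa> by (auto simp: zero_le_mult_iff)
    then show ?thesis using frac_eq_diff a by auto
  qed
  have cells: "pull \<kappa> M 0 A = (\<Union>i\<in>?I. S i -` A)"
  proof (intro set_eqI iffI)
    fix z assume "z \<in> pull \<kappa> M 0 A"
    then obtain x y where z: "z = (x, y)" "0 \<le> x" "x < 1" "0 \<le> y" "y < 1"
      "(frac (real \<kappa> * x), frac (real \<kappa> * y)) \<in> A"
      by (auto simp: pull_def two_point_map_def ifs_map_def unit_square_def)
    obtain a c where "a < \<kappa>" "c < \<kappa>" "frac (real \<kappa> * x) = real \<kappa> * x - real a"
      "frac (real \<kappa> * y) = real \<kappa> * y - real c"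
      using fr[of x] fr[of y] z by auto
    then show "z \<in> (\<Union>i\<in>?I. S i -` A)"
      using z by (intro UN_I[of "(a, c)"]) (auto simp: S_def)
  next
    fix z assume "z \<in> (\<Union>i\<in>?I. S i -` A)"
    then obtain a c x y where z: "a < \<kappa>" "c < \<kappa>" "z = (x, y)"
      "(real \<kappa> * x - real a, real \<kappa> * y - real c) \<in> A"
      by (cases z) (auto simp: S_def)
    moreover from this have "(real \<kappa> * x - real a, real \<kappa> * y - real c) \<in> unit_square"
      using A by blast
    ultimately show "z \<in> pull \<kappa> M 0 A"
      using fr'[of a x] fr'[of c y]
      by (auto simp: pull_def two_point_map_def ifs_map_def unit_square_def)
  qed
  have disj: "disjoint_family_on (\<lambda>i. S i -` A) ?I"
  proof -
    have "i = i'" if "i \<in> ?I" "i' \<in> ?I" "S i z \<in> A" "S i' z \<in> A" for i i' z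
    proof -
      obtain a c a' c' x y where eq: "i = (a, c)" "i' = (a', c')" "z = (x, y)"
        by (metis surj_pair)
      have "S i z \<in> unit_square" "S i' z \<in> unit_square" using that A by auto
      then have "\<bar>real a - real a'\<bar> < 1" "\<bar>real c - real c'\<bar> < 1"
        unfolding eq S_def by (auto simp: unit_square_def)
      then show ?thesis unfolding eq by auto
    qed
    then show ?thesis unfolding disjoint_family_on_def by blast
  qed
  have meas: "emeasure lborel (S i -` A) = ennreal (1 / (real \<kappa>)\<^sup>2) * emeasure lborel A" for i
    using emeasure_lborel_vimage_affine[of "real \<kappa>" A] \<kappa> A by (cases i) (simp add: S_def)
  have "emeasure lborel (pull \<kappa> M 0 A) = (\<Sum>i\<in>?I. emeasure lborel (S i -` A))"
    unfolding cells
    by (rule sum_emeasure[symmetric])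
       (use disj A sets_borel_vimage_affine in \<open>auto simp: S_def\<close>)
  also have "\<dots> = (of_nat (\<kappa> * \<kappa>) * ennreal (1 / (real \<kappa>)\<^sup>2)) * emeasure lborel A"
    unfolding meas by (simp add: mult.assoc)
  also have "of_nat (\<kappa> * \<kappa>) * ennreal (1 / (real \<kappa>)\<^sup>2) = ennreal (real (\<kappa> * \<kappa>) * (1 / (real \<kappa>)\<^sup>2))"
    by (simp only: ennreal_of_nat_eq_real_of_nat flip: ennreal_mult') 
  also have "\<dots> = 1" using \<kappa> by (simp add: power2_eq_square)
  finally show ?thesis using A by (simp add: diag_avg_0 pull_subset)
qed

text \<open>The truncated subtraction is intended: once scale \<open>0\<close> is reached, further expansion does not change
  the measure.\<close>

lemma diag_avg_expansion:
  assumes \<kappa>: "\<kappa> > 0" and A: "A \<in> sets borel" "A \<subseteq> unit_square"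
  shows "diag_avg \<kappa> h (pull (\<kappa> ^ n) M 0 A) = diag_avg \<kappa> (h - n) A"
proof (induction n arbitrary: h)
  case 0
  have "pull (\<kappa> ^ 0) M 0 A = A"
    using A(2) by (auto simp: pull_def two_point_map_def ifs_map_def unit_square_def frac_eq)
  then show ?case by simp
next
  case (Suc n)
  show ?case
    unfolding pull_0_power_Suc
    using Suc[of "h - 1"] \<kappa> A
    by (cases h) (simp_all add: diag_avg_expansion_0 diag_avg_expansion_Suc pull_borel pull_subset)
qed

section \<open>Stationary mixtures of the diagonal measures\<close>

definition diag_density :: "nat \<Rightarrow> (nat \<Rightarrow> real) \<Rightarrow> real \<times> real \<Rightarrow> ennreal" where
  "diag_density \<kappa> b z =
    (\<Sum>h. ennreal (b h) * (\<Sum>j<\<kappa> ^ h. ennreal (real \<kappa> ^ h) * indicator (diag_square \<kappa> h j) z))"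

definition diag_measure :: "nat \<Rightarrow> (nat \<Rightarrow> real) \<Rightarrow> (real \<times> real) measure" where
  "diag_measure \<kappa> b = density (restrict_space lborel unit_square) (diag_density \<kappa> b)"

lemma sets_diag_measure: "sets (diag_measure \<kappa> b) = sets (restrict_space borel unit_square)"
  unfolding diag_measure_def sets_density by (rule sets_restrict_space_cong) simp

lemma space_diag_measure: "space (diag_measure \<kappa> b) = unit_square"
  by (simp add: diag_measure_def space_restrict_space)

lemma mem_sets_diag_measure:
  "A \<in> sets (diag_measure \<kappa> b) \<longleftrightarrow> A \<in> sets borel \<and> A \<subseteq> unit_square"
  unfolding sets_diag_measure by (auto simp: sets_restrict_space_iff)

lemma diag_density_measurable: "diag_density \<kappa> b \<in> borel_measurable borel"
  unfolding diag_density_def by measurable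

lemma absolutely_continuous_diag_measure:
  "absolutely_continuous (restrict_space lborel unit_square) (diag_measure \<kappa> b)"
  unfolding diag_measure_def
  by (rule absolutely_continuousI_density)
     (use diag_density_measurable in \<open>simp add: measurable_restrict_space1\<close>)

lemma emeasure_diag_measure:
  assumes "A \<in> sets (diag_measure \<kappa> b)"
  shows "emeasure (diag_measure \<kappa> b) A = (\<Sum>h. ennreal (b h) * diag_avg \<kappa> h A)"
proof -
  have A [measurable]: "A \<in> sets borel" and subset: "A \<subseteq> unit_square"
    using assms by (auto simp: mem_sets_diag_measure)
  have "emeasure (diag_measure \<kappa> b) A =
      (\<integral>\<^sup>+z. diag_density \<kappa> b z * indicator A z \<partial>restrict_space lborel unit_square)"
    unfolding diag_measure_def
    by (rule emeasure_density)
       (use diag_density_measurable A subset in \<open>simp_all add: measurable_restrict_space1 sets_restrict_space_iff\<close>)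
  also have "\<dots> = (\<integral>\<^sup>+z. diag_density \<kappa> b z * indicator A z \<partial>lborel)"
    using subset by (subst nn_integral_restrict_space) (auto intro!: nn_integral_cong split: split_indicator)
  also have "\<dots> = (\<integral>\<^sup>+z. (\<Sum>h. ennreal (b h) *
      (\<Sum>j<\<kappa> ^ h. ennreal (real \<kappa> ^ h) * indicator (diag_square \<kappa> h j \<inter> A) z)) \<partial>lborel)"
    by (intro nn_integral_cong) (auto simp: diag_density_def split: split_indicator)
  also have "\<dots> = (\<Sum>h. \<integral>\<^sup>+z. ennreal (b h) *
      (\<Sum>j<\<kappa> ^ h. ennreal (real \<kappa> ^ h) * indicator (diag_square \<kappa> h j \<inter> A) z) \<partial>lborel)"
    by (intro nn_integral_suminf) measurable
  also have "\<dots> = (\<Sum>h. ennreal (b h) * diag_avg \<kappa> h A)"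
  proof (rule suminf_cong)
    fix h
    have "(\<integral>\<^sup>+z. (\<Sum>j<\<kappa> ^ h. ennreal (real \<kappa> ^ h) * indicator (diag_square \<kappa> h j \<inter> A) z) \<partial>lborel) =
        diag_avg \<kappa> h A"
      by (subst nn_integral_sum) (simp_all add: nn_integral_cmult_indicator diag_avg_def)
    moreover have "(\<lambda>z. \<Sum>j<\<kappa> ^ h. ennreal (real \<kappa> ^ h) * indicator (diag_square \<kappa> h j \<inter> A) z)
        \<in> borel_measurable lborel"
      by measurable
    ultimately show "(\<integral>\<^sup>+z. ennreal (b h) *
        (\<Sum>j<\<kappa> ^ h. ennreal (real \<kappa> ^ h) * indicator (diag_square \<kappa> h j \<inter> A) z) \<partial>lborel) =
        ennreal (b h) * diag_avg \<kappa> h A"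
      by (simp only: nn_integral_cmult)
  qed
  finally show ?thesis .
qed

lemma emeasure_lebesgue_restricted:
  "Q \<in> sets borel \<Longrightarrow> A \<in> sets borel \<Longrightarrow> emeasure (lebesgue_restricted Q) A = emeasure lborel (Q \<inter> A)"
  by (simp add: lebesgue_restricted_def emeasure_restricted)

text \<open>The \<open>k\<close> lowest scales are all moved to \<open>0\<close>, where their coefficients accumulate.\<close>

lemma suminf_shift_down:
  fixes f :: "nat \<Rightarrow> ennreal"
  shows "(\<Sum>h. f h * g (h - k)) = (\<Sum>h. (f (h + k) + (if h = 0 then \<Sum>j<k. f j else 0)) * g h)"
proof -
  have "(\<Sum>h. f h * g (h - k)) = (\<Sum>h. f (h + k) * g h) + (\<Sum>j<k. f j * g (j - k))"
    using suminf_offset[of "\<lambda>h. f h * g (h - k)" k] by simp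
  also have "(\<Sum>j<k. f j * g (j - k)) = (\<Sum>j<k. f j) * g 0"
    by (simp add: sum_distrib_right)
  also have "\<dots> = (\<Sum>h. (if h = 0 then \<Sum>j<k. f j else 0) * g h)"
    by (subst suminf_finite[of "{0}"]) auto
  also have "(\<Sum>h. f (h + k) * g h) + \<dots> = (\<Sum>h. (f (h + k) + (if h = 0 then \<Sum>j<k. f j else 0)) * g h)"
    by (simp add: suminf_add distrib_right)
  finally show ?thesis .
qed

lemma suminf_shift_up:
  fixes f :: "nat \<Rightarrow> ennreal"
  shows "(\<Sum>h. f h * g (h + l)) = (\<Sum>h. (if l \<le> h then f (h - l) else 0) * g h)"
  using suminf_offset[of "\<lambda>h. (if l \<le> h then f (h - l) else 0) * g h" l] by simp

text \<open>Pushing the mixture forward acts on its coefficients by the reflected walk on scales, so that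
  stationarity of the measure reduces to the balance equation of the coefficients.\<close>

lemma stationary_diag_measure:
  fixes p :: real and b :: "nat \<Rightarrow> real"
  assumes \<kappa>: "\<kappa> > 0" and p: "0 \<le> p" "p \<le> 1" and b: "\<And>h. b h \<ge> 0"
    and balance: "\<And>h. b h = p * (b (h + k) + (if h = 0 then \<Sum>j<k. b j else 0)) +
      (1 - p) * (if l \<le> h then b (h - l) else 0)"
  shows "stationary_measure (\<kappa> ^ k) (\<kappa> ^ l) p (diag_measure \<kappa> b)"
  unfolding stationary_measure_def
proof (intro conjI ballI)
  let ?m = "diag_measure \<kappa> b" and ?N = "\<kappa> ^ k" and ?M = "\<kappa> ^ l"
  show "sets ?m = sets (restrict_space borel unit_square)" by (rule sets_diag_measure)
  fix A assume A': "A \<in> sets ?m"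
  then have A: "A \<in> sets borel" "A \<subseteq> unit_square" by (auto simp: mem_sets_diag_measure)
  have distr: "emeasure (distr ?m ?m (two_point_map ?N ?M i)) A =
      (\<Sum>h. ennreal (b h) * diag_avg \<kappa> h (pull ?N ?M i A))" if i: "i \<le> ?M" for i
  proof -
    have pull: "B \<in> sets ?m \<Longrightarrow> pull ?N ?M i B \<in> sets ?m" for B
      by (simp add: mem_sets_diag_measure pull_borel pull_subset)
    have "two_point_map ?N ?M i \<in> measurable ?m ?m"
      using two_point_map_unit_square[OF _ i] pull
      by (auto simp: measurable_def space_diag_measure simp flip: pull_eq_vimage)
    then show ?thesis
      using A' by (simp add: emeasure_distr space_diag_measure emeasure_diag_measure pull flip: pull_eq_vimage)
  qed
  let ?a = "\<lambda>h. diag_avg \<kappa> h A"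
  have expand: "emeasure (distr ?m ?m (two_point_map ?N ?M 0)) A = (\<Sum>h. ennreal (b h) * ?a (h - k))"
    by (subst distr) (use \<kappa> A in \<open>simp_all add: diag_avg_expansion\<close>)
  have contract: "(\<Sum>i<?M. ennreal ((1 - p) / real ?M) * emeasure (distr ?m ?m (two_point_map ?N ?M (Suc i))) A) =
      ennreal (1 - p) * (\<Sum>h. ennreal (b h) * ?a (h + l))"
  proof -
    have coef: "ennreal ((1 - p) / real ?M) = ennreal (1 - p) * ennreal (1 / real \<kappa> ^ l)"
      using p by (simp flip: ennreal_mult)
    have "(\<Sum>i<?M. ennreal ((1 - p) / real ?M) * emeasure (distr ?m ?m (two_point_map ?N ?M (Suc i))) A) =
      (\<Sum>i<?M. \<Sum>h. ennreal (1 - p) * (ennreal (b h) *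
        (ennreal (1 / real \<kappa> ^ l) * diag_avg \<kappa> h (pull ?N ?M (Suc i) A))))"
      by (intro sum.cong refl)
         (simp add: distr coef mult.assoc mult.left_commute[of "ennreal (b _)"] del: of_nat_power)
    also have "\<dots> = (\<Sum>h. \<Sum>i<?M. ennreal (1 - p) * (ennreal (b h) *
        (ennreal (1 / real \<kappa> ^ l) * diag_avg \<kappa> h (pull ?N ?M (Suc i) A))))"
      by (rule suminf_sum[symmetric]) simp
    also have "\<dots> = (\<Sum>h. ennreal (1 - p) * (ennreal (b h) * ?a (h + l)))"
      using diag_avg_contractions[OF \<kappa> A(1)] by (simp flip: sum_distrib_left)
    finally show ?thesis by simp
  qed
  let ?down = "\<lambda>h. b (h + k) + (if h = 0 then \<Sum>j<k. b j else 0)"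
  let ?up = "\<lambda>h. if l \<le> h then b (h - l) else 0"
  have down: "(\<Sum>h. ennreal (b h) * ?a (h - k)) = (\<Sum>h. ennreal (?down h) * ?a h)"
    unfolding suminf_shift_down[where f = "\<lambda>h. ennreal (b h)" and g = ?a and k = k]
    by (intro suminf_cong) (simp add: b sum_nonneg sum_ennreal flip: ennreal_plus)
  have up: "(\<Sum>h. ennreal (b h) * ?a (h + l)) = (\<Sum>h. ennreal (?up h) * ?a h)"
    unfolding suminf_shift_up[where f = "\<lambda>h. ennreal (b h)" and g = ?a and l = l] by (intro suminf_cong) simp
  have coef: "ennreal (b h) = ennreal p * ennreal (?down h) + ennreal (1 - p) * ennreal (?up h)" for h
  proof -
    have nonneg: "?down h \<ge> 0" "?up h \<ge> 0" using b by (auto intro!: add_nonneg_nonneg sum_nonneg)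
    have "ennreal p * ennreal (?down h) + ennreal (1 - p) * ennreal (?up h) =
        ennreal (p * ?down h + (1 - p) * ?up h)"
      using nonneg p by (simp add: ennreal_mult ennreal_plus del: add_nonneg_eq_0_iff)
    then show ?thesis using balance[of h] by simp
  qed
  have "emeasure ?m A = (\<Sum>h. ennreal p * (ennreal (?down h) * ?a h) + ennreal (1 - p) * (ennreal (?up h) * ?a h))"
    unfolding emeasure_diag_measure[OF A'] coef by (simp only: distrib_right mult.assoc)
  also have "\<dots> = ennreal p * (\<Sum>h. ennreal (?down h) * ?a h) + ennreal (1 - p) * (\<Sum>h. ennreal (?up h) * ?a h)"
    by (subst suminf_add[symmetric]) simp_all
  also have "\<dots> = (\<Sum>i\<le>?M. ennreal (ifs_prob ?M p i) * emeasure (distr ?m ?m (two_point_map ?N ?M i)) A)"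
    unfolding sum.atMost_shift using contract expand by (simp add: ifs_prob_def down up)
  finally show "emeasure ?m A =
      (\<Sum>i\<le>?M. ennreal (ifs_prob ?M p i) * emeasure (distr ?m ?m (two_point_map ?N ?M i)) A)" .
qed

section \<open>The stationary measure\<close>

theorem theorem3p9:
  fixes N M \<kappa> k l :: nat and p0 :: real
  assumes "M \<ge> 2" and "N \<ge> 2"
    and "0 < p0" and "p0 < 1"
    and "lyapunov_exponent N M p0 > 0"
    and "\<kappa> > 1" and "k \<ge> 1" and "l \<ge> 1" and "coprime k l"
    and "N = \<kappa> ^ k" and "M = \<kappa> ^ l"
  shows "(\<exists>!\<nu>. diag_root p0 k l \<nu>) \<and>
    (\<exists>(m :: (real \<times> real) measure) (b :: nat \<Rightarrow> real).
       stationary_measure N M p0 m \<and>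
       absolutely_continuous (restrict_space lborel unit_square) m \<and>
       (\<forall>h. b h \<ge> 0) \<and>
       (\<forall>A\<in>sets m. emeasure m A =
          (\<Sum>h. ennreal (b h) *
            (\<Sum>j<\<kappa> ^ h. ennreal (real \<kappa> ^ h) *
               emeasure (lebesgue_restricted (diag_square \<kappa> h j)) A))) \<and>
       (\<forall>j. b (j + k + l) = 1 / p0 * b (j + l) - (1 - p0) / p0 * b j) \<and>
       (\<forall>\<nu>. diag_root p0 k l \<nu> \<longrightarrow>
          (\<exists>c>0. (\<lambda>h. b h / \<nu> ^ h) \<longlonglongrightarrow> c)))"
proof -
  let ?m = "diag_measure \<kappa>"
  have ln: "ln (real N) = real k * ln (real \<kappa>)" "ln (real M) = real l * ln (real \<kappa>)"
    using assms(6,10,11) by (simp_all add: ln_realpow)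
  have "lyapunov_exponent N M p0 = (p0 * real k - (1 - p0) * real l) * ln (real \<kappa>)"
    unfolding lyapunov_exponent_def ln by (simp add: algebra_simps)
  moreover have "ln (real \<kappa>) > 0" using assms(6) by simp
  ultimately have "(1 - p0) * real l < p0 * real k"
    using assms(5) by (simp add: zero_less_mult_iff)
  then have unique: "\<exists>!\<nu>. diag_root p0 k l \<nu>"
    using assms by (intro diag_root_unique)
  then obtain \<nu> where \<nu>: "diag_root p0 k l \<nu>" by blast
  interpret walk: lattice_walk p0 \<nu> k l
    using assms \<nu> by unfold_locales
  have "stationary_measure N M p0 (?m walk.weight)"
    unfolding assms(10,11)
    using assms by (intro stationary_diag_measure walk.weight_nonneg walk.weight_balance) auto
  moreover have "emeasure (?m walk.weight) A = (\<Sum>h. ennreal (walk.weight h) *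
      (\<Sum>j<\<kappa> ^ h. ennreal (real \<kappa> ^ h) * emeasure (lebesgue_restricted (diag_square \<kappa> h j)) A))"
    if A: "A \<in> sets (?m walk.weight)" for A
  proof -
    have "A \<in> sets borel" using A by (simp add: mem_sets_diag_measure)
    then show ?thesis
      unfolding emeasure_diag_measure[OF A] diag_avg_def
      by (simp only: emeasure_lebesgue_restricted[OF diag_square_borel])
  qed
  moreover have "\<exists>c>0. (\<lambda>h. walk.weight h / \<zeta> ^ h) \<longlonglongrightarrow> c" if "diag_root p0 k l \<zeta>" for \<zeta>
    using walk.weight_ratio_limit unique \<nu> that by blast
  ultimately show ?thesis
    using unique absolutely_continuous_diag_measure[of \<kappa> walk.weight] walk.weight_nonneg
      walk.weight_recurrence
    by (intro conjI exI[of _ "?m walk.weight"] exI[of _ walk.weight]) blast+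
qed

end
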